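(* Let $G$ be a finite simple undirected graph with $n$ vertices and $m\ge 1$ edges, let $\mu$ be the largest eigenvalue of its adjacency matrix, let $\beta=\frac{\mu n}{2m}$, and let $\chi(G)$ be its chromatic number. Then $$\chi(G)\le \frac{n}{\beta}.$$
   Context: The quantity $\beta = \mu/d = \frac{\mu n}{2m}$, where $d = 2m/n$ is the average degree, is a spectral measure of the irregularity of $G$. It is defined for graphs with at least one edge. *)

theory Defs
  imports "Graph_Theory.Pair_Digraph" "Jordan_Normal_Form.Spectral_Radius"
begin

text \<open>A finite simple undirected graph is a \<^locale>\<open>pair_graph\<close>: a finite, loop-free,
  symmetric digraph without parallel arcs. An undirected edge corresponds to two opposite arcs.\<close>

definition undirected_edges :: "'a pair_pre_digraph \<Rightarrow> 'a set set" where
  "undirected_edges G = {{u, v} | u v. (u, v) \<in> parcs G}"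

definition proper_coloring :: "'a pair_pre_digraph \<Rightarrow> nat \<Rightarrow> ('a \<Rightarrow> nat) \<Rightarrow> bool" where
  "proper_coloring G k c \<longleftrightarrow>
     (\<forall>v \<in> pverts G. c v < k) \<and> (\<forall>(u, v) \<in> parcs G. c u \<noteq> c v)"

definition chromatic_number :: "'a pair_pre_digraph \<Rightarrow> nat" where
  "chromatic_number G = (LEAST k. \<exists>c. proper_coloring G k c)"

text \<open>The rows and columns are ordered by \<open>vs\<close>, meant to be a duplicate-free enumeration of
  the vertices of \<open>G\<close>.\<close>

definition adjacency_mat :: "'a list \<Rightarrow> 'a pair_pre_digraph \<Rightarrow> real mat" where
  "adjacency_mat vs G = mat (length vs) (length vs)
     (\<lambda>(i, j). if (vs ! i, vs ! j) \<in> parcs G then 1 else 0)"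

text \<open>Meaningful for square matrices with at least one real eigenvalue, e.g. for nonempty real
  symmetric ones; otherwise \<^const>\<open>Max\<close> is applied to the empty set.\<close>

definition largest_eigenvalue :: "real mat \<Rightarrow> real" where
  "largest_eigenvalue A = Max (spectrum A)"

definition spectral_irregularity :: "'a list \<Rightarrow> 'a pair_pre_digraph \<Rightarrow> real" where
  "spectral_irregularity vs G =
     largest_eigenvalue (adjacency_mat vs G) * real (card (pverts G))
       / (2 * real (card (undirected_edges G)))"

end

(* The claim is chi * mu <= 2 m, where mu > 0. It follows from Wilf's bound chi <= mu + 1 and
   Stanley's bound mu^2 + mu <= 2 m.

   Wilf: mu dominates the Rayleigh quotient of every indicator vector 1_T, i.e. the average
   degree of the subgraph induced by T, so every such subgraph has a vertex of degree at most mu,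
   and greedy colouring needs at most floor(mu) + 1 colours.

   Stanley: let A x = mu x with |x| = 1. By Cauchy-Schwarz and looplessness,
   mu^2 x_v^2 <= d_v * (sum of x_w^2 over w ~ v) <= d_v (1 - x_v^2). Summing over v gives
   mu^2 <= 2 m - sum d_v x_v^2 <= 2 m - mu, since x^T A x <= sum d_v x_v^2. *)

theory Submission
  imports Defs "HOL-Analysis.Function_Topology" "HOL-Analysis.Convex"
begin

section \<open>The maximal Rayleigh quotient\<close>

text \<open>First-order optimality: the polynomial vanishes at 0 and is nonnegative, so it is
  minimal there and its derivative \<open>b\<close> at 0 is zero. It will turn maximality of the
  Rayleigh quotient into the eigenvalue equation.\<close>

lemma nonneg_quadratic_imp_linear_coeff_0:
  fixes b c :: real
  assumes "\<And>t. 0 \<le> b * t + c * t\<^sup>2"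
  shows "b = 0"
proof (rule ccontr)
  assume b: "b \<noteq> 0"
  \<comment> \<open>Any positive \<open>d\<close> above \<open>c\<close> serves: at t = -b/d the
    polynomial takes the value b^2/d^2 * (c - d), which is then negative.\<close>
  define d where "d = \<bar>c\<bar> + 1"
  have d: "d > 0" "c < d" by (auto simp: d_def)
  have "b * (- b / d) + c * (- b / d)\<^sup>2 = b\<^sup>2 / d\<^sup>2 * (c - d)"
    using d by (simp add: field_simps power2_eq_square)
  also have "\<dots> < 0"
    using b d by (intro mult_pos_neg) auto
  finally show False using assms[of "- b / d"] by linarith
qed

text \<open>The form y^T A y, with rows and columns indexed by the elements of \<open>V\<close>
  rather than by positions in an enumeration.\<close>

definition quad_form :: "'a set \<Rightarrow> ('a \<Rightarrow> 'a \<Rightarrow> real) \<Rightarrow> ('a \<Rightarrow> real) \<Rightarrow> real" where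
  "quad_form V a y = (\<Sum>v\<in>V. \<Sum>w\<in>V. a v w * y v * y w)"

text \<open>The sphere is a closed subset of a product of compact intervals, so Tychonoff applies
  even over an infinite type. Pinning the coordinates outside \<open>V\<close> to 0 keeps them from
  being unbounded.\<close>

lemma compact_unit_sphere_supported:
  fixes V :: "'a set"
  assumes "finite V"
  shows "compact {x :: 'a \<Rightarrow> real. (\<forall>v. v \<notin> V \<longrightarrow> x v = 0) \<and> (\<Sum>v\<in>V. (x v)\<^sup>2) = 1}"
proof -
  define B where "B = PiE UNIV (\<lambda>v. if v \<in> V then {-1..1::real} else {0})"
  have "compactin (product_topology (\<lambda>_. euclidean) UNIV) B"
    unfolding B_def by (subst compactin_PiE) auto
  then have "compact B"
    by (simp add: euclidean_product_topology)
  moreover have "closed {x :: 'a \<Rightarrow> real. (\<Sum>v\<in>V. (x v)\<^sup>2) = 1}"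
    by (intro closed_Collect_eq continuous_intros continuous_on_product_coordinates)
  ultimately have "compact (B \<inter> {x. (\<Sum>v\<in>V. (x v)\<^sup>2) = 1})"
    by (rule compact_Int_closed)
  also have "B \<inter> {x. (\<Sum>v\<in>V. (x v)\<^sup>2) = 1} =
      {x. (\<forall>v. v \<notin> V \<longrightarrow> x v = 0) \<and> (\<Sum>v\<in>V. (x v)\<^sup>2) = 1}"
  proof (intro equalityI subsetI)
    fix x assume "x \<in> {x :: 'a \<Rightarrow> real. (\<forall>v. v \<notin> V \<longrightarrow> x v = 0) \<and> (\<Sum>v\<in>V. (x v)\<^sup>2) = 1}"
    then have x: "\<And>v. v \<notin> V \<Longrightarrow> x v = 0" "(\<Sum>v\<in>V. (x v)\<^sup>2) = 1" by auto
    have "\<bar>x v\<bar> \<le> 1" if "v \<in> V" for v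
    proof -
      have "(x v)\<^sup>2 \<le> (\<Sum>v\<in>V. (x v)\<^sup>2)"
        using that assms by (intro member_le_sum) auto
      then show ?thesis using x by (simp add: abs_square_le_1)
    qed
    then have "x v \<in> (if v \<in> V then {-1..1} else {0})" for v
      using x(1)[of v] by (cases "v \<in> V") (fastforce simp: abs_le_iff)+
    then show "x \<in> B \<inter> {x. (\<Sum>v\<in>V. (x v)\<^sup>2) = 1}"
      using x(2) by (simp only: B_def PiE_UNIV_domain Pi_iff) simp
  next
    fix x assume x: "x \<in> B \<inter> {x. (\<Sum>v\<in>V. (x v)\<^sup>2) = 1}"
    have "x v = 0" if "v \<notin> V" for v
    proof -
      have "x v \<in> (if v \<in> V then {-1..1} else {0})"
        using x unfolding B_def by (auto simp only: PiE_iff)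
      then show ?thesis using that by simp
    qed
    then show "x \<in> {x. (\<forall>v. v \<notin> V \<longrightarrow> x v = 0) \<and> (\<Sum>v\<in>V. (x v)\<^sup>2) = 1}"
      using x by simp
  qed
  finally show ?thesis .
qed

text \<open>Expansion along the coordinate direction \<open>u\<close>. Symmetry merges the two cross
  terms, so the linear coefficient is twice the entry of A x at \<open>u\<close>.\<close>

lemma quad_form_add_delta:
  assumes V: "finite V" and u: "u \<in> V" and sym: "\<And>v w. a v w = a w v"
  shows "quad_form V a (\<lambda>v. x v + (if v = u then t else 0)) =
    quad_form V a x + 2 * t * (\<Sum>w\<in>V. a u w * x w) + a u u * t\<^sup>2"
proof -
  define e where "e v = (if v = u then t else 0)" for v
  have "quad_form V a (\<lambda>v. x v + e v) = quad_form V a x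
      + (\<Sum>v\<in>V. \<Sum>w\<in>V. a v w * e v * x w) + (\<Sum>v\<in>V. \<Sum>w\<in>V. a v w * x v * e w)
      + (\<Sum>v\<in>V. \<Sum>w\<in>V. a v w * e v * e w)"
    unfolding quad_form_def sum.distrib[symmetric]
    by (intro sum.cong refl) (simp add: algebra_simps)
  moreover have "(\<Sum>v\<in>V. \<Sum>w\<in>V. a v w * x v * e w) = (\<Sum>v\<in>V. \<Sum>w\<in>V. a v w * e v * x w)"
    by (subst sum.swap) (intro sum.cong refl, subst sym, simp add: algebra_simps)
  \<comment> \<open>Stated for arbitrary \<open>y\<close> because it serves both the cross term
    (\<open>y\<close> = \<open>x\<close>) and the quadratic term (\<open>y\<close> =
    \<open>e\<close>).\<close>
  moreover have lin: "(\<Sum>v\<in>V. \<Sum>w\<in>V. a v w * e v * y w) = t * (\<Sum>w\<in>V. a u w * y w)" for y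
  proof -
    have "(\<Sum>v\<in>V. \<Sum>w\<in>V. a v w * e v * y w) = (\<Sum>v\<in>V. if v = u then t * (\<Sum>w\<in>V. a u w * y w) else 0)"
      by (intro sum.cong refl) (auto simp: e_def sum_distrib_left algebra_simps)
    then show ?thesis using V u by simp
  qed
  moreover have "(\<Sum>w\<in>V. a u w * e w) = a u u * t"
  proof -
    have "(\<Sum>w\<in>V. a u w * e w) = (\<Sum>w\<in>V. if w = u then a u u * t else 0)"
      by (intro sum.cong refl) (auto simp: e_def)
    then show ?thesis using V u by simp
  qed
  ultimately show ?thesis
    unfolding e_def[symmetric] lin by (simp add: algebra_simps power2_eq_square)
qed

lemma sum_squares_add_delta:
  fixes x :: "'a \<Rightarrow> real"
  assumes V: "finite V" and u: "u \<in> V"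
  shows "(\<Sum>v\<in>V. (x v + (if v = u then t else 0))\<^sup>2) = (\<Sum>v\<in>V. (x v)\<^sup>2) + 2 * t * x u + t\<^sup>2"
proof -
  have "(\<Sum>v\<in>V. (x v + (if v = u then t else 0))\<^sup>2) =
      (\<Sum>v\<in>V. (x v)\<^sup>2 + (if v = u then 2 * t * x u + t\<^sup>2 else 0))"
    by (intro sum.cong refl) (auto simp: algebra_simps power2_eq_square)
  then show ?thesis using V u by (simp add: sum.distrib)
qed

text \<open>The form attains its maximum \<open>l\<close> on the compact unit sphere. Homogeneity
  extends the bound to all \<open>y\<close>, and perturbing the maximizer in one coordinate at a
  time shows that it is an eigenvector for \<open>l\<close>.\<close>

lemma max_Rayleigh_quotient_eigenvalue:
  fixes a :: "'a \<Rightarrow> 'a \<Rightarrow> real"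
  assumes V: "finite V" "V \<noteq> {}" and sym: "\<And>v w. a v w = a w v"
  obtains l x where "\<exists>v\<in>V. x v \<noteq> 0" "\<And>v. v \<in> V \<Longrightarrow> (\<Sum>w\<in>V. a v w * x w) = l * x v"
    "\<And>y. quad_form V a y \<le> l * (\<Sum>v\<in>V. (y v)\<^sup>2)"
proof -
  define S where "S = {x :: 'a \<Rightarrow> real. (\<forall>v. v \<notin> V \<longrightarrow> x v = 0) \<and> (\<Sum>v\<in>V. (x v)\<^sup>2) = 1}"
  obtain u0 where u0: "u0 \<in> V" using V by blast
  have "compact S"
    unfolding S_def by (rule compact_unit_sphere_supported[OF V(1)])
  moreover have "(\<lambda>v. if v = u0 then 1 else 0) \<in> S"
    using sum_squares_add_delta[OF V(1) u0, of "\<lambda>_. 0" 1] u0 by (auto simp: S_def)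
  then have "S \<noteq> {}" by blast
  moreover have "continuous_on UNIV (quad_form V a)"
    unfolding quad_form_def by (intro continuous_intros continuous_on_product_coordinates)
  then have "continuous_on S (quad_form V a)"
    by (rule continuous_on_subset) simp
  ultimately obtain x where xS: "x \<in> S" and mx: "\<And>y. y \<in> S \<Longrightarrow> quad_form V a y \<le> quad_form V a x"
    using continuous_attains_sup by metis
  define l where "l = quad_form V a x"
  have nx: "(\<Sum>v\<in>V. (x v)\<^sup>2) = 1" using xS by (simp add: S_def)
  have bound: "quad_form V a y \<le> l * (\<Sum>v\<in>V. (y v)\<^sup>2)" for y
  proof (cases "(\<Sum>v\<in>V. (y v)\<^sup>2) = 0")
    case True
    then have "\<forall>v\<in>V. y v = 0" using V by (simp add: sum_nonneg_eq_0_iff)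
    then have "quad_form V a y = 0" by (simp add: quad_form_def)
    then show ?thesis using True by simp
  next
    case False
    define N where "N = (\<Sum>v\<in>V. (y v)\<^sup>2)"
    have N: "N > 0" using False by (simp add: N_def sum_nonneg order_less_le)
    \<comment> \<open>Normalizing and cutting off outside \<open>V\<close> puts \<open>z\<close> in
      \<open>S\<close>; the form sees only values on \<open>V\<close>, so it is just scaled by
      1/N.\<close>
    define z where "z v = (if v \<in> V then y v / sqrt N else 0)" for v
    have "(\<Sum>v\<in>V. (z v)\<^sup>2) = (\<Sum>v\<in>V. (y v)\<^sup>2 / N)"
      using N by (intro sum.cong refl) (simp add: z_def power_divide)
    also have "\<dots> = 1" using N by (simp add: sum_divide_distrib[symmetric] N_def)
    finally have "z \<in> S" by (simp add: S_def z_def)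
    have "quad_form V a z = (\<Sum>v\<in>V. \<Sum>w\<in>V. a v w * y v * y w / N)"
      unfolding quad_form_def using N by (intro sum.cong refl) (simp add: z_def)
    also have "\<dots> = quad_form V a y / N"
      by (simp add: quad_form_def sum_divide_distrib)
    finally show ?thesis
      using mx[OF \<open>z \<in> S\<close>] N by (simp add: l_def N_def pos_divide_le_eq)
  qed
  have eig: "(\<Sum>w\<in>V. a u w * x w) = l * x u" if u: "u \<in> V" for u
  proof -
    \<comment> \<open>This is the slack of \<open>bound\<close> at x + t e_u. The constant terms
      cancel, since the form at \<open>x\<close> is \<open>l\<close> and \<open>x\<close> has norm
      1. As \<open>bound\<close> also holds off the sphere, no Lagrange multiplier enters.\<close>
    have "0 \<le> 2 * (l * x u - (\<Sum>w\<in>V. a u w * x w)) * t + (l - a u u) * t\<^sup>2" for t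
      using bound[of "\<lambda>v. x v + (if v = u then t else 0)"]
      unfolding quad_form_add_delta[OF V(1) u sym] sum_squares_add_delta[OF V(1) u] nx
        l_def[symmetric]
      by (simp add: algebra_simps)
    from nonneg_quadratic_imp_linear_coeff_0[OF this] show ?thesis by simp
  qed
  have "\<exists>v\<in>V. x v \<noteq> 0"
    using nx by (metis (no_types, lifting) sum.neutral zero_neq_one zero_power2)
  then show ?thesis using that eig bound by blast
qed

section \<open>Greedy colouring\<close>

text \<open>The assumption \<open>low\<close> is degeneracy. Remove a vertex with fewer than
  \<open>k\<close> neighbours in \<open>S\<close>, colour the rest by induction, and give that
  vertex a colour missing among its neighbours. Quantifying over all subsets makes the assumption
  pass to the smaller set.\<close>

lemma greedy_coloring:
  assumes "finite S" and sym: "sym E" and irr: "irrefl E"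
    and low: "\<And>T. T \<subseteq> S \<Longrightarrow> T \<noteq> {} \<Longrightarrow> \<exists>v\<in>T. card {w\<in>T. (v, w) \<in> E} < k"
  shows "\<exists>c :: 'a \<Rightarrow> nat. (\<forall>v\<in>S. c v < k) \<and> (\<forall>u\<in>S. \<forall>v\<in>S. (u, v) \<in> E \<longrightarrow> c u \<noteq> c v)"
  using assms(1) low
proof (induction S rule: finite_psubset_induct)
  case (psubset S)
  show ?case
  proof (cases "S = {}")
    case False
    then obtain v where v: "v \<in> S" and deg: "card {w\<in>S. (v, w) \<in> E} < k"
      using psubset.prems by blast
    have "S - {v} \<subset> S" using v by blast
    moreover have "\<exists>w\<in>T. card {u\<in>T. (w, u) \<in> E} < k" if "T \<subseteq> S - {v}" "T \<noteq> {}" for T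
      using psubset.prems that by blast
    ultimately obtain c where
      c: "\<forall>w\<in>S - {v}. c w < k" "\<forall>u\<in>S - {v}. \<forall>w\<in>S - {v}. (u, w) \<in> E \<longrightarrow> c u \<noteq> c w"
      using psubset.IH[of "S - {v}"] by blast
    have "card (c ` {w\<in>S. (v, w) \<in> E}) < card {..<k}"
      using deg card_image_le[of "{w\<in>S. (v, w) \<in> E}" c] psubset.hyps by simp
    then have "\<not> {..<k} \<subseteq> c ` {w\<in>S. (v, w) \<in> E}"
      using card_mono[of "c ` {w\<in>S. (v, w) \<in> E}" "{..<k}"] psubset.hyps by auto
    then obtain i where i: "i < k" "i \<notin> c ` {w\<in>S. (v, w) \<in> E}" by blast
    have i': "c w \<noteq> i" if "w \<in> S" "(v, w) \<in> E \<or> (w, v) \<in> E" for w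
      using i(2) that symD[OF sym] by blast
    have "\<forall>w\<in>S. (c(v := i)) w < k" using c(1) i(1) by simp
    moreover have "\<forall>u\<in>S. \<forall>w\<in>S. (u, w) \<in> E \<longrightarrow> (c(v := i)) u \<noteq> (c(v := i)) w"
      using c(2) i' irr by (auto simp: irrefl_def)
    ultimately show ?thesis by blast
  qed simp
qed

section \<open>Adjacency eigenvalues\<close>

definition adj :: "'a pair_pre_digraph \<Rightarrow> 'a \<Rightarrow> 'a \<Rightarrow> real" where
  "adj G v w = (if (v, w) \<in> parcs G then 1 else 0)"

lemma sum_set_nth:
  fixes f :: "'a \<Rightarrow> real"
  assumes "distinct vs"
  shows "(\<Sum>v\<in>set vs. f v) = (\<Sum>i<length vs. f (vs ! i))"
  using assms by (simp add: sum_list_distinct_conv_sum_set[symmetric] sum_list_sum_nth atLeast0LessThan)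

lemma adjacency_mat_mult_index:
  assumes "distinct vs" "i < length vs"
  shows "(adjacency_mat vs G *\<^sub>v vec (length vs) (\<lambda>j. x (vs ! j))) $ i =
    (\<Sum>w\<in>set vs. adj G (vs ! i) w * x w)"
  using assms
  by (simp add: adjacency_mat_def sum_set_nth scalar_prod_def adj_def atLeast0LessThan)

text \<open>The bridge between the matrix indexed by positions and functions on vertices: for
  distinct \<open>vs\<close>, the map from positions to entries is a bijection onto
  \<open>set vs\<close>, so vectors and functions on \<open>set vs\<close> correspond.\<close>

lemma eigenvalue_adjacency_mat_iff:
  assumes dist: "distinct vs"
  shows "eigenvalue (adjacency_mat vs G) k \<longleftrightarrow> (\<exists>x. (\<exists>v\<in>set vs. x v \<noteq> 0) \<and>
    (\<forall>v\<in>set vs. (\<Sum>w\<in>set vs. adj G v w * x w) = k * x v))" (is "?L \<longleftrightarrow> ?R")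
proof
  let ?n = "length vs"
  have dim: "dim_row (adjacency_mat vs G) = ?n"
    by (simp add: adjacency_mat_def)
  {
    assume ?L
    then obtain y where y: "y \<in> carrier_vec ?n" "y \<noteq> 0\<^sub>v ?n"
      and ev: "adjacency_mat vs G *\<^sub>v y = k \<cdot>\<^sub>v y"
      by (auto simp: eigenvalue_def eigenvector_def dim)
    \<comment> \<open>The inverse of indexing returns the unique position of a vertex in
      \<open>vs\<close>.\<close>
    define x where "x v = y $ (the_inv_into {..<?n} ((!) vs) v)" for v
    have xi: "x (vs ! i) = y $ i" if "i < ?n" for i
      using that dist by (simp add: x_def the_inv_into_f_f inj_on_def nth_eq_iff_index_eq)
    have yx: "y = vec ?n (\<lambda>j. x (vs ! j))"
      using y(1) by (intro eq_vecI) (auto simp: xi)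
    have "(\<Sum>w\<in>set vs. adj G v w * x w) = k * x v" if "v \<in> set vs" for v
    proof -
      from that obtain i where i: "i < ?n" "v = vs ! i" by (auto simp: in_set_conv_nth)
      have "(adjacency_mat vs G *\<^sub>v y) $ i = k * x v"
        unfolding ev using y(1) i by (simp add: xi)
      then show ?thesis
        using adjacency_mat_mult_index[OF dist i(1), of G x] i yx by simp
    qed
    moreover have "\<exists>v\<in>set vs. x v \<noteq> 0"
    proof (rule ccontr)
      assume "\<not> ?thesis"
      then have "y = 0\<^sub>v ?n" by (subst yx, intro eq_vecI) auto
      with y(2) show False by simp
    qed
    ultimately show ?R by blast
  }
  {
    assume ?R
    then obtain x where nz: "\<exists>v\<in>set vs. x v \<noteq> 0"
      and ev: "\<And>v. v \<in> set vs \<Longrightarrow> (\<Sum>w\<in>set vs. adj G v w * x w) = k * x v" by blast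
    define y where "y = vec ?n (\<lambda>j. x (vs ! j))"
    have "adjacency_mat vs G *\<^sub>v y = k \<cdot>\<^sub>v y"
    proof (rule eq_vecI)
      fix i assume "i < dim_vec (k \<cdot>\<^sub>v y)"
      then have "i < ?n" by (simp add: y_def)
      then show "(adjacency_mat vs G *\<^sub>v y) $ i = (k \<cdot>\<^sub>v y) $ i"
        using adjacency_mat_mult_index[OF dist, of i G x] ev by (simp add: y_def)
    qed (simp add: dim y_def)
    moreover have "y \<noteq> 0\<^sub>v ?n"
    proof
      assume y0: "y = 0\<^sub>v ?n"
      obtain i where "i < ?n" "x (vs ! i) \<noteq> 0" using nz by (auto simp: in_set_conv_nth)
      then show False using arg_cong[OF y0, of "\<lambda>y. y $ i"] by (simp add: y_def)
    qed
    moreover have "y \<in> carrier_vec ?n" by (simp add: y_def)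
    ultimately show ?L by (auto simp: eigenvalue_def eigenvector_def dim)
  }
qed

section \<open>Arc counts and Stanley's bound\<close>

context pair_graph
begin

lemma sym_parcs: "sym (parcs G)"
  using pair_sym_arcs by (simp add: symmetric_def)

lemma irrefl_parcs: "irrefl (parcs G)"
  using pair_no_loops by (fastforce simp: irrefl_def)

lemma adj_commute: "adj G v w = adj G w v"
  using symD[OF sym_parcs] by (auto simp: adj_def)

lemma sum_adj_eq_card_parcs: "(\<Sum>v\<in>pverts G. \<Sum>w\<in>pverts G. adj G v w) = real (card (parcs G))"
proof -
  have "(\<Sum>v\<in>pverts G. \<Sum>w\<in>pverts G. adj G v w) =
      (\<Sum>e\<in>pverts G \<times> pverts G. if e \<in> parcs G then 1 else 0)"
    by (simp add: sum.cartesian_product adj_def split_def)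
  also have "\<dots> = real (card ((pverts G \<times> pverts G) \<inter> parcs G))"
    using pair_finite_verts by (simp add: sum.If_cases)
  also have "(pverts G \<times> pverts G) \<inter> parcs G = parcs G"
    using arc_fst_in_verts arc_snd_in_verts by fastforce
  finally show ?thesis .
qed

text \<open>Arcs are grouped by their underlying edge; an edge has at most two orientations. This
  converts arc counts into 2 m.\<close>

lemma card_parcs_le: "card (parcs G) \<le> 2 * card (undirected_edges G)"
proof -
  let ?U = "undirected_edges G"
  have U: "?U = (\<lambda>(u, v). {u, v}) ` parcs G"
    unfolding undirected_edges_def by auto
  define F where "F e = {(u, v). {u, v} = e}" for e :: "'a set"
  have fin: "finite ?U" unfolding U using pair_finite_arcs by simp
  have fib: "finite (F e) \<and> card (F e) \<le> 2" if "e \<in> ?U" for e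
  proof -
    from that obtain a b where "e = {a, b}" by (auto simp: undirected_edges_def)
    \<comment> \<open>Enclosing the fibre in the set of a two-element list bounds its size by the
      list length, without distinguishing a = b from a \<noteq> b.\<close>
    then have sub: "F e \<subseteq> set [(a, b), (b, a)]"
      by (auto simp: F_def doubleton_eq_iff)
    have "card (F e) \<le> card (set [(a, b), (b, a)])"
      by (rule card_mono[OF finite_set sub])
    also have "\<dots> \<le> length [(a, b), (b, a)]" by (rule card_length)
    finally have "card (F e) \<le> 2" by simp
    moreover have "finite (F e)" by (rule finite_subset[OF sub finite_set])
    ultimately show ?thesis by blast
  qed
  have "parcs G \<subseteq> (\<Union>e\<in>?U. F e)" by (auto simp: U F_def)
  then have "card (parcs G) \<le> card (\<Union>e\<in>?U. F e)"
    using fin fib by (intro card_mono) auto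
  also have "\<dots> \<le> (\<Sum>e\<in>?U. card (F e))"
    using fin by (rule card_UN_le)
  also have "\<dots> \<le> card ?U * 2" using sum_bounded_above[of ?U "\<lambda>e. card (F e)" 2] fib by simp
  finally show ?thesis by simp
qed

text \<open>The argument works for any eigenvalue \<open>k\<close> of either sign. The eigenvector
  is not normalized: its squared norm \<open>N\<close> is carried along and cancelled at the
  end.\<close>

lemma Stanley_bound:
  assumes nz: "\<exists>v\<in>pverts G. x v \<noteq> 0"
    and ev: "\<And>v. v \<in> pverts G \<Longrightarrow> (\<Sum>w\<in>pverts G. adj G v w * x w) = k * x v"
  shows "k\<^sup>2 + k \<le> real (card (parcs G))"
proof -
  let ?V = "pverts G" and ?a = "adj G"
  define N where "N = (\<Sum>v\<in>?V. (x v)\<^sup>2)"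
  define d where "d v = (\<Sum>w\<in>?V. ?a v w)" for v
  note fin = pair_finite_verts
  have a: "?a v w * ?a v w = ?a v w" "?a v w \<ge> 0" "?a v w \<le> 1" "?a v v = 0" for v w
    using irrefl_parcs by (auto simp: adj_def irrefl_def)
  have d0: "d v \<ge> 0" for v by (auto simp: d_def a intro: sum_nonneg)
  obtain u where u: "u \<in> ?V" "x u \<noteq> 0" using nz by blast
  have N: "N > 0" unfolding N_def using u fin by (intro sum_pos2[of _ u]) auto
  have loc: "k\<^sup>2 * (x v)\<^sup>2 \<le> d v * (N - (x v)\<^sup>2)" if v: "v \<in> ?V" for v
  proof -
    \<comment> \<open>Entries are 0 or 1, hence idempotent. Doubling the factor makes Cauchy-Schwarz
      yield the degree \<open>d v\<close> while the other sum still sees only neighbours of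
      \<open>v\<close>.\<close>
    have "k\<^sup>2 * (x v)\<^sup>2 = (\<Sum>w\<in>?V. ?a v w * (?a v w * x w))\<^sup>2"
      using ev[OF v] by (simp add: mult.assoc[symmetric] a power_mult_distrib)
    also have "\<dots> \<le> (\<Sum>w\<in>?V. (?a v w)\<^sup>2) * (\<Sum>w\<in>?V. (?a v w * x w)\<^sup>2)"
      by (rule Cauchy_Schwarz_ineq_sum)
    also have "(\<Sum>w\<in>?V. (?a v w)\<^sup>2) = d v"
      by (simp add: d_def power2_eq_square a)
    \<comment> \<open>Looplessness removes the term at \<open>v\<close>. This gains the summand -(x
      v)^2, which later supplies the linear term \<open>k\<close>.\<close>
    also have "(\<Sum>w\<in>?V. (?a v w * x w)\<^sup>2) \<le> (\<Sum>w\<in>?V - {v}. (x w)\<^sup>2)"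
    proof -
      have "(\<Sum>w\<in>?V. (?a v w * x w)\<^sup>2) = (\<Sum>w\<in>?V - {v}. (?a v w * x w)\<^sup>2)"
        using v fin by (simp add: sum.remove[of _ v] a)
      also have "\<dots> \<le> (\<Sum>w\<in>?V - {v}. (x w)\<^sup>2)"
        by (intro sum_mono) (simp add: adj_def)
      finally show ?thesis .
    qed
    also have "(\<Sum>w\<in>?V - {v}. (x w)\<^sup>2) = N - (x v)\<^sup>2"
      using v fin by (simp add: sum_diff1 N_def)
    finally show ?thesis using d0 by (simp add: mult_left_mono)
  qed
  have "k * N = (\<Sum>v\<in>?V. x v * (\<Sum>w\<in>?V. ?a v w * x w))"
    unfolding N_def by (subst sum_distrib_left, intro sum.cong refl) (simp add: ev power2_eq_square)
  also have "\<dots> = (\<Sum>v\<in>?V. \<Sum>w\<in>?V. ?a v w * (x v * x w))"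
    by (simp add: sum_distrib_left algebra_simps)
  \<comment> \<open>From 2 p q \<le> p^2 + q^2; by symmetry of the adjacency both halves then sum to
    the same degree-weighted sum.\<close>
  also have "\<dots> \<le> (\<Sum>v\<in>?V. \<Sum>w\<in>?V. ?a v w * (((x v)\<^sup>2 + (x w)\<^sup>2) / 2))"
  proof (intro sum_mono mult_left_mono a)
    fix v w
    show "x v * x w \<le> ((x v)\<^sup>2 + (x w)\<^sup>2) / 2"
      using sum_squares_bound[of "x v" "x w"] by simp
  qed
  also have "\<dots> = (\<Sum>v\<in>?V. \<Sum>w\<in>?V. ?a v w * (x v)\<^sup>2) / 2 + (\<Sum>v\<in>?V. \<Sum>w\<in>?V. ?a v w * (x w)\<^sup>2) / 2"
    by (simp add: sum.distrib sum_divide_distrib algebra_simps add_divide_distrib)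
  also have "(\<Sum>v\<in>?V. \<Sum>w\<in>?V. ?a v w * (x w)\<^sup>2) = (\<Sum>v\<in>?V. \<Sum>w\<in>?V. ?a v w * (x v)\<^sup>2)"
    by (subst sum.swap) (intro sum.cong refl, subst adj_commute, simp)
  also have "(\<Sum>v\<in>?V. \<Sum>w\<in>?V. ?a v w * (x v)\<^sup>2) = (\<Sum>v\<in>?V. d v * (x v)\<^sup>2)"
    by (simp add: d_def sum_distrib_right)
  finally have form: "k * N \<le> (\<Sum>v\<in>?V. d v * (x v)\<^sup>2)" by simp
  have "k\<^sup>2 * N = (\<Sum>v\<in>?V. k\<^sup>2 * (x v)\<^sup>2)"
    by (simp add: N_def sum_distrib_left)
  also have "\<dots> \<le> (\<Sum>v\<in>?V. d v * (N - (x v)\<^sup>2))"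
    by (intro sum_mono loc)
  also have "\<dots> = (\<Sum>v\<in>?V. d v) * N - (\<Sum>v\<in>?V. d v * (x v)\<^sup>2)"
    by (simp add: right_diff_distrib sum_subtractf sum_distrib_right)
  also have "(\<Sum>v\<in>?V. d v) = real (card (parcs G))"
    unfolding d_def by (rule sum_adj_eq_card_parcs)
  \<comment> \<open>Adding \<open>form\<close> cancels the subtracted degree-weighted sum.\<close>
  finally have "(k\<^sup>2 + k) * N \<le> real (card (parcs G)) * N"
    using form by (simp add: algebra_simps)
  then show ?thesis using N by simp
qed

section \<open>Induced degrees and Wilf's bound\<close>

lemma quad_form_adj_indicator:
  assumes "T \<subseteq> pverts G"
  shows "quad_form (pverts G) (adj G) (\<lambda>v. if v \<in> T then 1 else 0) =
    (\<Sum>v\<in>T. real (card {w\<in>T. (v, w) \<in> parcs G}))"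
proof -
  let ?V = "pverts G"
  note fin = pair_finite_verts
  have "quad_form ?V (adj G) (\<lambda>v. if v \<in> T then 1 else 0) =
      (\<Sum>v\<in>?V. if v \<in> T then (\<Sum>w\<in>?V. if w \<in> {w\<in>T. (v, w) \<in> parcs G} then 1 else 0) else 0)"
    unfolding quad_form_def
    by (intro sum.cong refl) (auto simp: adj_def intro!: sum.cong sum.neutral)
  also have "\<dots> = (\<Sum>v\<in>T. \<Sum>w\<in>?V. if w \<in> {w\<in>T. (v, w) \<in> parcs G} then 1 else 0)"
    using assms fin by (simp add: sum.If_cases Int_absorb1)
  also have "\<dots> = (\<Sum>v\<in>T. real (card {w\<in>T. (v, w) \<in> parcs G}))"
  proof (intro sum.cong refl)
    fix v
    have "?V \<inter> {w\<in>T. (v, w) \<in> parcs G} = {w\<in>T. (v, w) \<in> parcs G}" using assms by blast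
    then show "(\<Sum>w\<in>?V. if w \<in> {w\<in>T. (v, w) \<in> parcs G} then 1 else 0) =
        real (card {w\<in>T. (v, w) \<in> parcs G})"
      using fin by (simp add: sum.If_cases del: mem_Collect_eq)
  qed
  finally show ?thesis .
qed

text \<open>A minimum is at most the average. If all induced degrees exceeded \<open>l\<close>, the
  form at the indicator of \<open>T\<close> would exceed \<open>l\<close> times
  \<open>card T\<close>, the squared norm of that indicator.\<close>

lemma exists_low_degree_vertex:
  assumes bound: "\<And>y. quad_form (pverts G) (adj G) y \<le> l * (\<Sum>v\<in>pverts G. (y v)\<^sup>2)"
    and T: "T \<subseteq> pverts G" "T \<noteq> {}"
  shows "\<exists>v\<in>T. real (card {w\<in>T. (v, w) \<in> parcs G}) \<le> l"
proof (rule ccontr)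
  assume "\<not> ?thesis"
  then have gt: "l < real (card {w\<in>T. (v, w) \<in> parcs G})" if "v \<in> T" for v
    using that by force
  have finT: "finite T" using T pair_finite_verts by (rule_tac finite_subset)
  have "(\<Sum>v\<in>pverts G. (if v \<in> T then 1 else 0 :: real)\<^sup>2) = (\<Sum>v\<in>pverts G. if v \<in> T then 1 else 0)"
    by (intro sum.cong) auto
  also have "\<dots> = real (card T)"
    using T pair_finite_verts by (simp add: sum.If_cases Int_absorb1)
  finally have "(\<Sum>v\<in>T. real (card {w\<in>T. (v, w) \<in> parcs G})) \<le> l * card T"
    using bound[of "\<lambda>v. if v \<in> T then 1 else 0"] quad_form_adj_indicator[OF T(1)] by simp
  moreover have "(\<Sum>v\<in>T. l) < (\<Sum>v\<in>T. real (card {w\<in>T. (v, w) \<in> parcs G}))"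
    using finT T(2) gt by (rule sum_strict_mono)
  ultimately show False by (simp add: mult.commute)
qed

lemma Wilf_bound:
  assumes bound: "\<And>y. quad_form (pverts G) (adj G) y \<le> l * (\<Sum>v\<in>pverts G. (y v)\<^sup>2)"
    and l: "l \<ge> 0"
  shows "real (chromatic_number G) \<le> l + 1"
proof -
  \<comment> \<open>Degrees are integers, so a degree at most \<open>l\<close> is at most its floor
    and hence below \<open>k\<close>; nonnegativity of \<open>l\<close> gives k \<le> l + 1.\<close>
  define k where "k = nat \<lfloor>l\<rfloor> + 1"
  have "\<exists>v\<in>T. card {w\<in>T. (v, w) \<in> parcs G} < k" if "T \<subseteq> pverts G" "T \<noteq> {}" for T
  proof -
    obtain v where v: "v \<in> T" "real (card {w\<in>T. (v, w) \<in> parcs G}) \<le> l"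
      using exists_low_degree_vertex[OF bound \<open>T \<subseteq> _\<close> \<open>T \<noteq> {}\<close>] by blast
    then have "card {w\<in>T. (v, w) \<in> parcs G} < k"
      using le_nat_floor[OF v(2)] by (simp add: k_def)
    with v(1) show ?thesis by blast
  qed
  from greedy_coloring[OF pair_finite_verts sym_parcs irrefl_parcs this]
  obtain c where "\<forall>v\<in>pverts G. c v < k"
    "\<forall>u\<in>pverts G. \<forall>v\<in>pverts G. (u, v) \<in> parcs G \<longrightarrow> c u \<noteq> c v" by blast
  moreover have "u \<in> pverts G \<and> v \<in> pverts G" if "(u, v) \<in> parcs G" for u v
    using arc_fst_in_verts[OF that] arc_snd_in_verts[OF that] by simp
  ultimately have "proper_coloring G k c"
    by (auto simp: proper_coloring_def)
  then have "chromatic_number G \<le> k"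
    unfolding chromatic_number_def by (blast intro: Least_le)
  then have "real (chromatic_number G) \<le> real k" by simp
  also have "\<dots> \<le> l + 1" using l of_nat_floor[of l] by (simp add: k_def)
  finally show ?thesis .
qed

text \<open>In the subgraph induced by the two ends of an arc each vertex has a neighbour, so the
  low-degree vertex there already forces l \<ge> 1.\<close>

lemma Rayleigh_bound_pos:
  assumes bound: "\<And>y. quad_form (pverts G) (adj G) y \<le> l * (\<Sum>v\<in>pverts G. (y v)\<^sup>2)"
    and arc: "(u, v) \<in> parcs G"
  shows "l > 0"
proof -
  have V: "u \<in> pverts G" "v \<in> pverts G"
    using arc_fst_in_verts[OF arc] arc_snd_in_verts[OF arc] by auto
  have vu: "(v, u) \<in> parcs G" using symD[OF sym_parcs arc] .
  have pos: "card {w \<in> {u, v}. (x, w) \<in> parcs G} > 0" if "x \<in> {u, v}" for x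
    using that arc vu by (auto simp: card_gt_0_iff)
  obtain x where "x \<in> {u, v}" "real (card {w \<in> {u, v}. (x, w) \<in> parcs G}) \<le> l"
    using exists_low_degree_vertex[OF bound, of "{u, v}"] V by auto
  with pos[of x] show ?thesis by linarith
qed

end

section \<open>Combination of the two bounds\<close>

theorem theorem1:
  fixes G :: "'a pair_pre_digraph" and vs :: "'a list"
  assumes "pair_graph G"
    and "card (undirected_edges G) \<ge> 1"
    and "distinct vs" and "set vs = pverts G"
  shows "real (chromatic_number G) \<le> real (card (pverts G)) / spectral_irregularity vs G"
proof -
  interpret pair_graph G by fact
  let ?A = "adjacency_mat vs G"
  define \<mu> where "\<mu> = largest_eigenvalue ?A"
  define m where "m = real (card (undirected_edges G))"
  have "undirected_edges G \<noteq> {}" using assms(2) by auto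
  then obtain u v where arc: "(u, v) \<in> parcs G" by (auto simp: undirected_edges_def)
  then have V: "pverts G \<noteq> {}" using arc_fst_in_verts by blast
  obtain l x where x: "\<exists>v\<in>pverts G. x v \<noteq> 0"
      "\<And>v. v \<in> pverts G \<Longrightarrow> (\<Sum>w\<in>pverts G. adj G v w * x w) = l * x v"
    and bound: "\<And>y. quad_form (pverts G) (adj G) y \<le> l * (\<Sum>v\<in>pverts G. (y v)\<^sup>2)"
    by (rule max_Rayleigh_quotient_eigenvalue[of "pverts G" "adj G", OF pair_finite_verts V adj_commute]) (rule that)
  have l: "l > 0" using Rayleigh_bound_pos[OF bound arc] .
  \<comment> \<open>The spectrum is thereby nonempty, so with finiteness its \<open>Max\<close> is
    attained. Wilf's bound passes from \<open>l\<close> to \<mu> through l \<le> \<mu>, while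
    Stanley's bound is applied to \<mu> itself.\<close>
  have spec: "l \<in> spectrum ?A"
    using x eigenvalue_adjacency_mat_iff[OF assms(3)] assms(4) by (auto simp: spectrum_def)
  have fin: "finite (spectrum ?A)"
    by (rule card_finite_spectrum(1)[of _ "length vs"]) (simp add: adjacency_mat_def)
  have "l \<le> \<mu>" unfolding \<mu>_def largest_eigenvalue_def using fin spec by simp
  have "\<mu> \<in> spectrum ?A" unfolding \<mu>_def largest_eigenvalue_def using fin spec by (intro Max_in) auto
  then obtain y where "\<exists>v\<in>pverts G. y v \<noteq> 0"
      "\<And>v. v \<in> pverts G \<Longrightarrow> (\<Sum>w\<in>pverts G. adj G v w * y w) = \<mu> * y v"
    unfolding spectrum_def mem_Collect_eq eigenvalue_adjacency_mat_iff[OF assms(3)] assms(4) by blast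
  then have "\<mu>\<^sup>2 + \<mu> \<le> real (card (parcs G))"
    by (rule Stanley_bound)
  also have "\<dots> \<le> 2 * m" using card_parcs_le by (simp add: m_def)
  finally have stanley: "\<mu>\<^sup>2 + \<mu> \<le> 2 * m" .
  have "real (chromatic_number G) \<le> \<mu> + 1"
    using Wilf_bound[OF bound] l \<open>l \<le> \<mu>\<close> by simp
  then have "real (chromatic_number G) * \<mu> \<le> (\<mu> + 1) * \<mu>"
    using l \<open>l \<le> \<mu>\<close> by (intro mult_right_mono) auto
  also have "\<dots> \<le> 2 * m" using stanley by (simp add: algebra_simps power2_eq_square)
  finally have "real (chromatic_number G) \<le> 2 * m / \<mu>"
    using l \<open>l \<le> \<mu>\<close> by (simp add: pos_le_divide_eq)
  \<comment> \<open>A positive number of vertices lets n cancel in n / (\<mu> n / (2 m)), leaving 2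
    m / \<mu>.\<close>
  moreover have "card (pverts G) > 0" using V pair_finite_verts by (simp add: card_gt_0_iff)
  ultimately show ?thesis
    unfolding spectral_irregularity_def \<mu>_def[symmetric] m_def[symmetric]
    by (simp add: card_gt_0_iff)
qed

end
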